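(* Let $H$ be a non-cyclic abelian group of order $n > 1$ such that $n$ is not a prime integer, i.e., $H \cong Z_{m_1}\oplus\cdots\oplus Z_{m_i}$ with $i \geq 2$, $m_1 \geq 2$, $m_1 \mid m_2 \mid \cdots \mid m_i$, and $n = m_1\cdots m_i$. Let $m > 1$ be a positive integer such that every prime factor of $n$ is also a prime factor of $m$, and let $k = \gcd(m,n)$. For each $1 \leq j \leq i$, let $d_j = \gcd(m,m_j) = \gcd(k,m_j)$, and let $w_j$ be the least positive integer such that $m_j \mid d_j^{w_j}$. The following statements hold: (1) If $w_{i-1} = w_i$ or $\operatorname{diam}(d_i\text{-}G(Z_{m_i})) = 2w_i$, then $\operatorname{diam}(m\text{-}G(H)) = \operatorname{diam}(k\text{-}G(H)) = \operatorname{diam}((d_1,\dots,d_i)\text{-}PG(H)) = 2w_i$. (2) If $w_{i-1} = w_i-1$ and $\operatorname{diam}(d_i\text{-}G(Z_{m_i})) \neq 2w_i$, then $\operatorname{diam}(m\text{-}G(H)) = \operatorname{diam}(k\text{-}G(H)) = \operatorname{diam}((d_1,\dots,d_i)\text{-}PG(H)) = 2w_i-1$. (3) If $w_{i-1} = w_i-c$ for some integer $c \geq 2$, then $\operatorname{diam}(m\text{-}G(H)) = \operatorname{diam}(k\text{-}G(H)) = \operatorname{diam}((d_1,\dots,d_i)\text{-}PG(H)) = \operatorname{diam}(d_i\text{-}G(Z_{m_i}))$.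
   Context: $Z_r$ is the additive cyclic group of integers modulo $r$. For a finite abelian group $H$ (written additively) and an integer $r>1$, the graph $r\text{-}G(H)$ is the simple undirected graph with vertex set $H$ in which two distinct vertices $a,b$ are adjacent if and only if $ra=b$ or $rb=a$. For $H = Z_{m_1}\oplus\cdots\oplus Z_{m_i}$ with $i\ge 2$, $m_1\ge 2$, $m_1\mid m_2\mid\cdots\mid m_i$, and for integers $d_j\geq 2$ ($1\le j\le i$) such that $d_j \mid m_j$ and every prime factor of $m_j$ is a prime factor of $d_j$, the $(d_1,\dots,d_i)$-product graph $(d_1,\dots,d_i)\text{-}PG(H)$ is the simple undirected graph with vertex set $H$ in which two distinct vertices $x=(x_1,\dots,x_i)$, $y=(y_1,\dots,y_i)$ are adjacent if and only if $y=(d_1x_1,\dots,d_ix_i)$ or $x=(d_1y_1,\dots,d_iy_i)$. For $H\cong Z_{m_1}\oplus\cdots\oplus Z_{m_i}$, $(d_1,\dots,d_i)\text{-}PG(H)$ denotes this graph on $Z_{m_1}\oplus\cdots\oplus Z_{m_i}$. The diameter of a graph is the maximum of the distances (lengths of shortest paths) over all pairs of vertices. *)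

theory Defs
  imports
    "HOL-Computational_Algebra.Primes"
    "HOL-Algebra.Product_Groups"
    "Graph_Theory.Pair_Digraph"
    "Graph_Theory.Shortest_Path"
begin

text \<open>
  A finite simple undirected graph is a \<^locale>\<open>pair_graph\<close>: an edge is present as both ordered
  pairs of its ends.
\<close>

definition power_graph :: "nat \<Rightarrow> ('a, 'b) monoid_scheme \<Rightarrow> 'a pair_pre_digraph" where
  "power_graph r H = \<lparr> pverts = carrier H,
     parcs = {(a, b). a \<in> carrier H \<and> b \<in> carrier H \<and> a \<noteq> b \<and>
                      (a [^]\<^bsub>H\<^esub> r = b \<or> b [^]\<^bsub>H\<^esub> r = a)} \<rparr>"

text \<open>
  HOL-Algebra groups are written multiplicatively, so the multiple \<open>r a\<close> in an abelian group \<open>H\<close>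
  is the power of \<open>a\<close> in \<open>H\<close> with exponent \<open>r\<close>.
  The elements of the sum of the cyclic groups of orders \<open>M 1, \<dots>, M i\<close> below are functions on
  \<open>{1..i}\<close> that are \<^const>\<open>undefined\<close> elsewhere.
\<close>

definition cyclic_sum :: "nat \<Rightarrow> (nat \<Rightarrow> nat) \<Rightarrow> (nat \<Rightarrow> int) monoid" where
  "cyclic_sum i M = product_group {1..i} (\<lambda>j. integer_mod_group (M j))"

definition scale :: "nat \<Rightarrow> (nat \<Rightarrow> nat) \<Rightarrow> (nat \<Rightarrow> nat) \<Rightarrow> (nat \<Rightarrow> int) \<Rightarrow> nat \<Rightarrow> int" where
  "scale i M d x = (\<lambda>j\<in>{1..i}. x j [^]\<^bsub>integer_mod_group (M j)\<^esub> d j)"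

text \<open>
  The definition makes sense for all \<open>M\<close> and \<open>d\<close>; the usual side conditions are that \<open>2 \<le> d j\<close>,
  that \<open>d j\<close> divides \<open>M j\<close>, and that every prime factor of \<open>M j\<close> divides \<open>d j\<close>.
\<close>

definition product_graph ::
    "nat \<Rightarrow> (nat \<Rightarrow> nat) \<Rightarrow> (nat \<Rightarrow> nat) \<Rightarrow> (nat \<Rightarrow> int) pair_pre_digraph" where
  "product_graph i M d = \<lparr> pverts = carrier (cyclic_sum i M),
     parcs = {(x, y). x \<in> carrier (cyclic_sum i M) \<and> y \<in> carrier (cyclic_sum i M) \<and> x \<noteq> y \<and>
                      (y = scale i M d x \<or> x = scale i M d y)} \<rparr>"

text \<open>With unit weights the cost of a walk is its length; unreachable vertices have distance \<open>\<infinity>\<close>.\<close>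

definition distance :: "'a pair_pre_digraph \<Rightarrow> 'a \<Rightarrow> 'a \<Rightarrow> ereal" where
  "distance G u v = wf_digraph.\<mu> (with_proj G) (\<lambda>_. 1) u v"

text \<open>Meaningful for finite graphs with at least one vertex.\<close>

definition diameter :: "'a pair_pre_digraph \<Rightarrow> ereal" where
  "diameter G = Max {distance G u v | u v. u \<in> pverts G \<and> v \<in> pverts G}"

lemma pair_graph_power_graph:
  assumes "finite (carrier H)"
  shows "pair_graph (power_graph r H)"
proof
  show "finite (parcs (power_graph r H))"
    by (rule finite_subset[of _ "carrier H \<times> carrier H"]) (auto simp: power_graph_def assms)
qed (auto simp: power_graph_def assms symmetric_def intro!: symI)

lemma pair_graph_product_graph:
  assumes "\<And>j. j \<in> {1..i} \<Longrightarrow> M j > 0"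
  shows "pair_graph (product_graph i M d)"
proof -
  have fin: "finite (carrier (cyclic_sum i M))"
    unfolding cyclic_sum_def carrier_product_group
    by (rule finite_PiE) (use assms in \<open>force simp: carrier_integer_mod_group\<close>)+
  show ?thesis
  proof
    show "finite (parcs (product_graph i M d))"
      by (rule finite_subset[of _ "carrier (cyclic_sum i M) \<times> carrier (cyclic_sum i M)"])
         (auto simp: product_graph_def fin)
  qed (auto simp: product_graph_def fin symmetric_def intro!: symI)
qed

end

theory Submission
  imports Defs
begin

text \<open>
  All four graphs join each element \<open>x\<close> of a finite group to its image \<open>f x\<close> under an endomorphism
  \<open>f\<close>: multiplication by \<open>m\<close>, by \<open>k\<close>, by \<open>d i\<close>, or componentwise by the \<open>d j\<close>. Every prime dividing
  the group order divides the multiplier, so \<open>f\<close> is nilpotent and the graph is a tree rooted at the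
  neutral element. The distance of \<open>x\<close> and \<open>y\<close> is the least \<open>a + b\<close> with \<open>f\<^sup>a x = f\<^sup>b y\<close>.

  Let \<open>w\<close> be the height of the tree and let \<open>c e\<close> be the order of the image of \<open>f\<^sup>e\<close>, so that
  \<open>c w = 1 < c (w - 1)\<close>. These orders alone determine the diameter (\<open>diameter_eq\<close>).
  \<^item> If \<open>c (w - 1) > 2\<close>, two vertices of full height \<open>w\<close> lie on different branches at the root, and
    the diameter is \<open>2 w\<close>.
  \<^item> If \<open>c (w - 1) = 2\<close>, all vertices of full height lie above one child \<open>z\<close> of the root, and the
    diameter is at most \<open>2 w - 1\<close>. For \<open>w > 1\<close> this value is attained exactly when some vertex of
    height \<open>w - 1\<close> lies on another branch, that is, when the kernel of \<open>f\<close> has a third element inside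
    the image of \<open>f\<close> iterated \<open>w - 2\<close> times. That image maps onto a group of order 2, so it has
    twice as many elements as this part of the kernel, and the condition becomes \<open>c (w - 2) > 4\<close>.
    If it fails, the diameter is \<open>2 w - 2\<close>. For \<open>w = 1\<close> the graph is a single edge.

  On a direct sum the orders of the images multiply, and in \<open>Z\<^sub>N\<close> the set of multiples of \<open>r\<close> depends
  only on \<open>gcd r N\<close>. Hence both graphs on \<open>H\<close> and the product graph share the sequence
  \<open>c = c\<^sub>1 \<cdots> c\<^sub>i\<close>, where \<open>c\<^sub>j e\<close> counts the multiples of \<open>m\<^sup>e\<close> in the \<open>j\<close>-th summand, and
  \<open>c\<^sub>j e = 1\<close> exactly when \<open>w j \<le> e\<close>. The three cases of the theorem are then a comparison of \<open>c\<close>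
  with its last factor \<open>c\<^sub>i\<close>: the other factors are trivial from \<open>w (i - 1)\<close> on and the factor
  \<open>c\<^sub>i\<^sub>-\<^sub>1\<close> is at least 2 before that.
\<close>

section \<open>Distances in the graph of a self-map\<close>

definition functional_graph :: "'a set \<Rightarrow> ('a \<Rightarrow> 'a) \<Rightarrow> 'a pair_pre_digraph" where
  "functional_graph A f =
     \<lparr> pverts = A, parcs = {(a, b). a \<in> A \<and> b \<in> A \<and> a \<noteq> b \<and> (f a = b \<or> f b = a)} \<rparr>"

lemma functional_graph_simps [simp]:
  "pverts (functional_graph A f) = A"
  "(a, b) \<in> parcs (functional_graph A f) \<longleftrightarrow>
     a \<in> A \<and> b \<in> A \<and> a \<noteq> b \<and> (f a = b \<or> f b = a)"
  by (auto simp: functional_graph_def)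

interpretation functional_graph: pair_wf_digraph "functional_graph A f" for A f
  by unfold_locales auto

lemma power_graph_eq_functional_graph:
  "power_graph r H = functional_graph (carrier H) (\<lambda>x. x [^]\<^bsub>H\<^esub> r)"
  by (simp add: power_graph_def functional_graph_def)

lemma product_graph_eq_functional_graph:
  "product_graph i M d = functional_graph (carrier (cyclic_sum i M)) (scale i M d)"
  unfolding product_graph_def functional_graph_def by (simp add: eq_commute)

lemma funpow_in_carrier:
  assumes "f \<in> A \<rightarrow> A" "x \<in> A"
  shows "(f ^^ e) x \<in> A"
  using assms by (induction e) auto

text \<open>
  The walk follows the iterates of \<open>f\<close> from \<open>u\<close> to the meeting point and then those from \<open>v\<close>
  backwards. It may be shorter than \<open>a + b\<close> because a step at a fixed point of \<open>f\<close> is not an edge.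
\<close>
lemma awalk_of_meeting_iterates:
  assumes f: "f \<in> A \<rightarrow> A" and v: "v \<in> A"
  shows "u \<in> A \<Longrightarrow> (f ^^ a) u = (f ^^ b) v \<Longrightarrow>
    \<exists>p. functional_graph.awalk A f u p v \<and> length p \<le> a + b"
proof (induction a arbitrary: u)
  case (Suc a)
  have "f u \<in> A" and "(f ^^ a) (f u) = (f ^^ b) v"
    using Suc.prems f by (auto simp: funpow_swap1)
  then obtain p where p: "functional_graph.awalk A f (f u) p v" "length p \<le> a + b"
    using Suc.IH by blast
  show ?case
  proof (cases "f u = u")
    case True
    with p show ?thesis by auto
  next
    case False
    then have "functional_graph.awalk A f u ((u, f u) # p) v"
      using p Suc.prems \<open>f u \<in> A\<close> by (auto simp: functional_graph.awalk_Cons_iff)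
    with p show ?thesis by (intro exI[of _ "(u, f u) # p"]) auto
  qed
next
  case 0
  then show ?case
  proof (induction b arbitrary: u)
    case 0
    then show ?case by (intro exI[of _ "[]"]) (auto simp: functional_graph.awalk_Nil_iff)
  next
    case (Suc b)
    let ?u' = "(f ^^ b) v"
    have u': "?u' \<in> A" using funpow_in_carrier f v by metis
    then obtain p where p: "functional_graph.awalk A f ?u' p v" "length p \<le> b"
      using Suc.IH[of ?u'] by auto
    show ?case
    proof (cases "u = ?u'")
      case True
      with p show ?thesis by auto
    next
      case False
      then have "functional_graph.awalk A f u ((u, ?u') # p) v"
        using p Suc.prems u' by (auto simp: functional_graph.awalk_Cons_iff)
      with p show ?thesis by (intro exI[of _ "(u, ?u') # p"]) auto
    qed
  qed
qed

text \<open>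
  A detour never helps: an edge that goes from \<open>u\<close> back to a preimage \<open>u'\<close> is either undone by the
  next application of \<open>f\<close>, or \<open>u'\<close> is itself an iterate of \<open>v\<close> and then so is \<open>u\<close>.
\<close>
lemma meeting_iterates_of_awalk:
  "functional_graph.awalk A f u p v \<Longrightarrow> \<exists>a b. a + b \<le> length p \<and> (f ^^ a) u = (f ^^ b) v"
proof (induction p arbitrary: u)
  case Nil
  then show ?case by (auto simp: functional_graph.awalk_Nil_iff intro!: exI[of _ "0::nat"])
next
  case (Cons e p)
  obtain u' where e: "e = (u, u')" and edge: "f u = u' \<or> f u' = u"
    and walk: "functional_graph.awalk A f u' p v"
    using Cons.prems by (cases e) (auto simp: functional_graph.awalk_Cons_iff)
  obtain a b where ab: "a + b \<le> length p" "(f ^^ a) u' = (f ^^ b) v"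
    using Cons.IH[OF walk] by blast
  consider "f u = u'" | "f u' = u" "a = 0" | a' where "f u' = u" "a = Suc a'"
    using edge by (cases a) auto
  then show ?case
  proof cases
    case 1
    then show ?thesis
      using ab by (intro exI[of _ "Suc a"] exI[of _ b]) (auto simp: funpow_swap1)
  next
    case 2
    then show ?thesis
      using ab by (intro exI[of _ 0] exI[of _ "Suc b"]) auto
  next
    case 3
    then show ?thesis
      using ab by (intro exI[of _ a'] exI[of _ b]) (auto simp: funpow_swap1)
  qed
qed

lemma distance_functional_graph_le:
  assumes "f \<in> A \<rightarrow> A" "u \<in> A" "v \<in> A" "(f ^^ a) u = (f ^^ b) v" "a + b \<le> l"
  shows "distance (functional_graph A f) u v \<le> ereal (real l)"
proof -
  obtain p where p: "functional_graph.awalk A f u p v" "length p \<le> a + b"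
    using awalk_of_meeting_iterates assms by metis
  have "distance (functional_graph A f) u v \<le> ereal (real (length p))"
    using functional_graph.min_cost_le_walk_cost[OF p(1), of "\<lambda>_. 1"]
    by (simp add: distance_def functional_graph.awalk_cost_def sum_list_triv)
  also have "\<dots> \<le> ereal (real l)" using p assms by simp
  finally show ?thesis .
qed

lemma distance_functional_graph_ge:
  assumes "\<And>a b. (f ^^ a) u = (f ^^ b) v \<Longrightarrow> l \<le> a + b"
  shows "ereal (real l) \<le> distance (functional_graph A f) u v"
  unfolding distance_def functional_graph.\<mu>_def
proof (rule INF_greatest)
  fix p assume "p \<in> {p. functional_graph.awalk A f u p v}"
  then have "functional_graph.awalk A f u p v" by simp
  then obtain a b where "a + b \<le> length p" "(f ^^ a) u = (f ^^ b) v"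
    using meeting_iterates_of_awalk[of A f u p v] by blast
  with assms have "l \<le> length p" by force
  then show "ereal (real l) \<le> ereal (functional_graph.awalk_cost (\<lambda>_. 1) p)"
    by (simp add: functional_graph.awalk_cost_def sum_list_triv)
qed

text \<open>
  This reduces the computation of a diameter to statements about iterates of \<open>f\<close>: all pairs meet
  within \<open>l\<close> steps, and one pair does not meet earlier.
\<close>
lemma diameter_functional_graph_eq:
  assumes "finite A" and f: "f \<in> A \<rightarrow> A"
    and upper: "\<And>u v. u \<in> A \<Longrightarrow> v \<in> A \<Longrightarrow> \<exists>a b. a + b \<le> l \<and> (f ^^ a) u = (f ^^ b) v"
    and "x \<in> A" "y \<in> A"
    and lower: "\<And>a b. (f ^^ a) x = (f ^^ b) y \<Longrightarrow> l \<le> a + b"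
  shows "diameter (functional_graph A f) = ereal (real l)"
proof -
  let ?d = "distance (functional_graph A f)"
  have le: "?d u v \<le> ereal (real l)" if "u \<in> A" "v \<in> A" for u v
    using upper[OF that] distance_functional_graph_le[OF f that] by blast
  have "{?d u v | u v. u \<in> A \<and> v \<in> A} = (\<lambda>(u, v). ?d u v) ` (A \<times> A)" by auto
  with \<open>finite A\<close> have "finite {?d u v | u v. u \<in> A \<and> v \<in> A}" by simp
  moreover have "?d x y = ereal (real l)"
    using le[OF \<open>x \<in> A\<close> \<open>y \<in> A\<close>] distance_functional_graph_ge[where A = A, OF lower]
    by (rule antisym)
  ultimately show ?thesis
    unfolding diameter_def functional_graph_simps
    using le \<open>x \<in> A\<close> \<open>y \<in> A\<close> by (intro Max_eqI) (blast | force)+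
qed

section \<open>Nilpotent endomorphisms of finite groups\<close>

lemma obtain_third:
  assumes "card S > 2"
  obtains u where "u \<in> S" "u \<noteq> a" "u \<noteq> b"
proof -
  have "\<not> S \<subseteq> {a, b}"
    using assms card_mono[of "{a, b}" S] by (auto simp: card_insert_if split: if_splits)
  with that show ?thesis by blast
qed

text \<open>
  Here \<open>c e\<close> stands for the order of the image of \<open>f\<^sup>e\<close> and \<open>w\<close> for the nilpotency index. The test
  \<open>w = 1\<close> keeps the truncated difference \<open>w - 2\<close> from being used there: for \<open>w = 1\<close> and
  \<open>c 0 = 2\<close> the graph is a single edge, of diameter \<open>2 w - 1\<close>.
\<close>
definition nilpotent_diameter :: "(nat \<Rightarrow> nat) \<Rightarrow> nat \<Rightarrow> nat" where
  "nilpotent_diameter c w =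
     (if c (w - 1) > 2 then 2 * w else if w = 1 \<or> c (w - 2) > 4 then 2 * w - 1 else 2 * w - 2)"

text \<open>
  The two cardinality conditions say that \<open>w\<close> is the least exponent for which the iterate of \<open>f\<close>
  is trivial. They are stated by orders of images because these are what transfers along an
  isomorphism and multiplies over a direct sum.
\<close>
locale nilpotent_endomorphism = group A for A (structure) +
  fixes f :: "'a \<Rightarrow> 'a" and w :: nat
  assumes endo: "f \<in> hom A A"
    and finite_carrier: "finite (carrier A)"
    and w_pos: "0 < w"
    and image_trivial: "card ((f ^^ w) ` carrier A) = 1"
    and image_nontrivial: "card ((f ^^ (w - 1)) ` carrier A) > 1"
begin

lemma funpow_hom: "f ^^ e \<in> hom A A"
proof (induction e)
  case (Suc e)
  then show ?case using endo by (auto simp: hom_def Pi_def)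
qed (auto simp: hom_def)

lemma funpow_closed [simp]: "x \<in> carrier A \<Longrightarrow> (f ^^ e) x \<in> carrier A"
  using funpow_hom hom_in_carrier by metis

lemma funpow_one [simp]: "(f ^^ e) \<one> = \<one>"
  using hom_one[OF funpow_hom] is_group by blast

lemma funpow_ge_w:
  assumes "w \<le> e" "x \<in> carrier A"
  shows "(f ^^ e) x = \<one>"
proof -
  obtain o' where o': "(f ^^ w) ` carrier A = {o'}"
    using image_trivial card_1_singletonE by metis
  have "\<one> \<in> (f ^^ w) ` carrier A" using funpow_one[of w] one_closed by (metis imageI)
  with o' have img: "(f ^^ w) ` carrier A = {\<one>}" by auto
  have "(f ^^ e) x = (f ^^ w) ((f ^^ (e - w)) x)"
    using assms by (metis comp_apply funpow_add le_add_diff_inverse)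
  with img assms show ?thesis by auto
qed

lemma obtain_full_height:
  obtains x where "x \<in> carrier A" "(f ^^ (w - 1)) x \<noteq> \<one>"
proof -
  have "\<not> (f ^^ (w - 1)) ` carrier A \<subseteq> {\<one>}"
    using image_nontrivial card_mono[of "{\<one>}" "(f ^^ (w - 1)) ` carrier A"] by auto
  with that show ?thesis by auto
qed

lemma funpow_shift:
  assumes "(f ^^ a) x = (f ^^ b) y" "a \<le> e"
  shows "(f ^^ e) x = (f ^^ (e - a + b)) y"
proof -
  have "(f ^^ e) x = (f ^^ (e - a)) ((f ^^ a) x)"
    using assms(2) by (metis comp_apply funpow_add le_add_diff_inverse2)
  then show ?thesis using assms(1) by (simp add: funpow_add)
qed

lemma funpow_one_mono:
  assumes "(f ^^ a) x = \<one>" "a \<le> e"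
  shows "(f ^^ e) x = \<one>"
  using funpow_shift[of a x 0 \<one> e] assms by simp

text \<open>
  The elements \<open>x\<close> and \<open>y\<close> have heights \<open>p + 1\<close> and \<open>q + 1\<close> and lie above different children of the
  root. If their iterates met before \<open>x\<close> reaches the root, then the two paths would coincide from
  there on, and comparing heights shows that they would use the same child.
\<close>
lemma branch_leave:
  assumes x: "(f ^^ p) x \<noteq> \<one>" "(f ^^ Suc p) x = \<one>"
    and y: "(f ^^ q) y \<noteq> \<one>" "(f ^^ Suc q) y = \<one>"
    and neq: "(f ^^ p) x \<noteq> (f ^^ q) y"
    and meet: "(f ^^ a) x = (f ^^ b) y"
  shows "Suc p \<le> a"
proof (rule ccontr)
  assume "\<not> Suc p \<le> a"
  then have a: "a \<le> p" by simp
  have "(f ^^ p) x = (f ^^ (p - a + b)) y"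
    using funpow_shift[OF meet a] .
  moreover have "(f ^^ (Suc p - a + b)) y = \<one>"
    using funpow_shift[OF meet, of "Suc p"] a x by simp
  moreover have "p - a + b < Suc q"
    using calculation(1) x(1) funpow_one_mono[OF y(2), of "p - a + b"] by force
  moreover have "q < Suc p - a + b"
    using calculation(2) y(1) funpow_one_mono[of "Suc p - a + b" y q] by force
  ultimately have "p - a + b = q" using a by linarith
  with \<open>(f ^^ p) x = (f ^^ (p - a + b)) y\<close> neq show False by simp
qed

lemma distinct_branches:
  assumes "(f ^^ p) x \<noteq> \<one>" "(f ^^ Suc p) x = \<one>"
    and "(f ^^ q) y \<noteq> \<one>" "(f ^^ Suc q) y = \<one>"
    and "(f ^^ p) x \<noteq> (f ^^ q) y"
    and "(f ^^ a) x = (f ^^ b) y"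
  shows "Suc p + Suc q \<le> a + b"
  using branch_leave[OF assms] branch_leave[OF assms(3,4,1,2) assms(5,6)[symmetric]] by linarith

text \<open>
  Each application of \<open>f\<close> lowers the height by one, and \<open>x\<close> has the largest possible height; so \<open>y\<close>
  reaches a common vertex other than the root in at most as many steps as \<open>x\<close>.
\<close>
lemma meeting_of_full_height:
  assumes "x \<in> carrier A" "y \<in> carrier A" "(f ^^ (w - 1)) x \<noteq> \<one>"
    and "(f ^^ a) x = (f ^^ b) y" "a \<le> w - 1"
  shows "b \<le> a"
proof (rule ccontr)
  assume "\<not> b \<le> a"
  then have "(f ^^ (w - 1 - a + b)) y = \<one>"
    using assms by (intro funpow_ge_w) auto
  with funpow_shift[OF assms(4,5)] assms(3) show False by simp
qed

text \<open>
  Two vertices of full height can meet other than at the root only after equally many steps, and the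
  hypothesis \<open>neq\<close> rules out \<open>w - 2\<close> steps or fewer.
\<close>
lemma full_height_split:
  assumes x: "x \<in> carrier A" "(f ^^ (w - 1)) x \<noteq> \<one>"
    and y: "y \<in> carrier A" "(f ^^ (w - 1)) y \<noteq> \<one>"
    and neq: "(f ^^ (w - 2)) x \<noteq> (f ^^ (w - 2)) y"
    and meet: "(f ^^ a) x = (f ^^ b) y"
  shows "2 * w - 2 \<le> a + b"
proof (cases "a < w - 1 \<or> b < w - 1")
  case True
  then have "a = b"
    using meeting_of_full_height[OF x(1) y(1) x(2) meet]
      meeting_of_full_height[OF y(1) x(1) y(2) meet[symmetric]] by force
  with True have "(f ^^ (w - 2)) x = (f ^^ (w - 2)) y"
    using funpow_shift[OF meet, of "w - 2"] by simp
  with neq show ?thesis by simp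
qed auto

text \<open>
  Both fibres of \<open>f\<close> on the image of \<open>f\<^sup>e\<close> are cosets of the kernel, so they have the same size.
\<close>
lemma card_image_eq_twice_card_kernel:
  assumes two: "card ((f ^^ Suc e) ` carrier A) = 2"
  shows "card ((f ^^ e) ` carrier A) = 2 * card {u \<in> (f ^^ e) ` carrier A. f u = \<one>}"
proof -
  let ?B = "(f ^^ e) ` carrier A"
  have fB: "f ` ?B = (f ^^ Suc e) ` carrier A" by (auto simp: image_image)
  have one: "\<one> \<in> ?B" "\<one> \<in> f ` ?B"
    using funpow_one[of e] funpow_one[of "Suc e"] one_closed unfolding fB by (metis imageI)+
  obtain z where z: "f ` ?B = {\<one>, z}" "z \<noteq> \<one>"
    using two one(2) unfolding fB card_2_iff by (metis doubleton_eq_iff insert_iff singletonD)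
  obtain s where s: "s \<in> ?B" "f s = z" using z by (metis imageE insertCI)
  interpret B: subgroup ?B A
    using group_hom.img_is_subgroup[of A A "f ^^ e"] funpow_hom is_group
    by (simp add: group_hom_def group_hom_axioms_def)
  have hom: "f (a \<otimes> b) = f a \<otimes> f b" if "a \<in> ?B" "b \<in> ?B" for a b
    using that hom_mult[OF endo] B.subset by blast
  have f1: "f \<one> = \<one>" using funpow_one[of 1] by simp
  have closed: "f a \<in> carrier A" if "a \<in> ?B" for a
    using that hom_in_carrier[OF endo] B.subset by blast
  have "bij_betw (\<lambda>u. s \<otimes> u) {u \<in> ?B. f u = \<one>} {u \<in> ?B. f u = z}"
  proof (rule bij_betw_byWitness[where f' = "\<lambda>u. inv s \<otimes> u"])
    have sc: "s \<in> carrier A" using s B.subset by blast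
    show "\<forall>u\<in>{u \<in> ?B. f u = \<one>}. inv s \<otimes> (s \<otimes> u) = u"
      using sc B.subset by (auto simp: m_assoc[symmetric])
    show "\<forall>u\<in>{u \<in> ?B. f u = z}. s \<otimes> (inv s \<otimes> u) = u"
      using sc B.subset by (auto simp: m_assoc[symmetric])
    show "(\<lambda>u. s \<otimes> u) ` {u \<in> ?B. f u = \<one>} \<subseteq> {u \<in> ?B. f u = z}"
    proof (rule image_subsetI)
      fix u assume "u \<in> {u \<in> ?B. f u = \<one>}"
      then have u: "u \<in> ?B" "f u = \<one>" by blast+
      have "s \<otimes> u \<in> ?B" using s u B.m_closed by blast
      moreover have "f (s \<otimes> u) = z" using hom[OF s(1) u(1)] u s closed[OF s(1)] by simp
      ultimately show "s \<otimes> u \<in> {u \<in> ?B. f u = z}" by blast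
    qed
    show "(\<lambda>u. inv s \<otimes> u) ` {u \<in> ?B. f u = z} \<subseteq> {u \<in> ?B. f u = \<one>}"
    proof (rule image_subsetI)
      fix u assume "u \<in> {u \<in> ?B. f u = z}"
      then have u: "u \<in> ?B" "f u = z" by blast+
      have s': "inv s \<in> ?B" using s B.m_inv_closed by blast
      have "inv s \<otimes> u \<in> ?B" using u s' B.m_closed by blast
      moreover have "f (inv s) \<otimes> f s = \<one>" using hom[OF s' s(1)] sc f1 by simp
      then have "f (inv s \<otimes> u) = \<one>" using hom[OF s' u(1)] u s by simp
      ultimately show "inv s \<otimes> u \<in> {u \<in> ?B. f u = \<one>}" by blast
    qed
  qed
  then have eq: "card {u \<in> ?B. f u = z} = card {u \<in> ?B. f u = \<one>}"
    by (rule sym[OF bij_betw_same_card])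
  have "?B = {u \<in> ?B. f u = \<one>} \<union> {u \<in> ?B. f u = z}" using z by blast
  moreover have "finite ?B" using finite_carrier by simp
  ultimately have "card ?B = card {u \<in> ?B. f u = \<one>} + card {u \<in> ?B. f u = z}"
    using z(2) card_Un_disjoint[of "{u \<in> ?B. f u = \<one>}" "{u \<in> ?B. f u = z}"] by fastforce
  with eq show ?thesis by simp
qed

text \<open>
  An image of order 2 has only one nontrivial element, so all vertices of full height lie above the
  same child of the root.
\<close>
lemma full_height_unique:
  assumes two: "card ((f ^^ (w - 1)) ` carrier A) = 2"
    and x: "x \<in> carrier A" "(f ^^ (w - 1)) x \<noteq> \<one>"
    and y: "y \<in> carrier A" "(f ^^ (w - 1)) y \<noteq> \<one>"
  shows "(f ^^ (w - 1)) x = (f ^^ (w - 1)) y"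
proof -
  have "\<one> \<in> (f ^^ (w - 1)) ` carrier A"
    using funpow_one[of "w - 1"] one_closed by (metis imageI)
  moreover have "(f ^^ (w - 1)) x \<in> (f ^^ (w - 1)) ` carrier A"
    "(f ^^ (w - 1)) y \<in> (f ^^ (w - 1)) ` carrier A" using x y by auto
  moreover obtain p q where "(f ^^ (w - 1)) ` carrier A = {p, q}"
    using two unfolding card_2_iff by blast
  ultimately show ?thesis using x(2) y(2) by (metis insert_iff singletonD)
qed

text \<open>
  The extremal pairs are: two vertices of full height above different children of the root
  (\<open>2 w\<close>); a vertex of full height and one of height \<open>w - 1\<close> above another child (\<open>2 w - 1\<close>); and
  \<open>x\<close> with \<open>x \<otimes> f x\<close>, both of full height (\<open>2 w - 2\<close>).
\<close>
theorem diameter_eq: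
  "diameter (functional_graph (carrier A) f) =
     ereal (real (nilpotent_diameter (\<lambda>e. card ((f ^^ e) ` carrier A)) w))"
proof -
  let ?c = "\<lambda>e. card ((f ^^ e) ` carrier A)"
  have f: "f \<in> carrier A \<rightarrow> carrier A" using endo by (auto simp: hom_def)
  have Sw: "Suc (w - 1) = w" using w_pos by simp
  have fin: "finite ((f ^^ e) ` carrier A)" for e using finite_carrier by simp
  have top: "(f ^^ w) x = \<one>" if "x \<in> carrier A" for x using that funpow_ge_w by blast
  note diam = diameter_functional_graph_eq[OF finite_carrier f]
  consider (six) "?c (w - 1) > 2" | (one) "?c (w - 1) = 2" "w = 1 \<or> ?c (w - 2) > 4"
    | (two) "?c (w - 1) = 2" "w \<noteq> 1" "?c (w - 2) \<le> 4"
    using image_nontrivial by linarith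
  then show ?thesis
  proof cases
    case six
    obtain x y where x: "x \<in> carrier A" "(f ^^ (w - 1)) x \<noteq> \<one>"
      and y: "y \<in> carrier A" "(f ^^ (w - 1)) y \<noteq> \<one>"
      and neq: "(f ^^ (w - 1)) x \<noteq> (f ^^ (w - 1)) y"
    proof -
      obtain x where x: "x \<in> carrier A" "(f ^^ (w - 1)) x \<noteq> \<one>" using obtain_full_height .
      from six obtain u where "u \<in> (f ^^ (w - 1)) ` carrier A" "u \<noteq> \<one>" "u \<noteq> (f ^^ (w - 1)) x"
        by (rule obtain_third)
      with x that show ?thesis by auto
    qed
    have "diameter (functional_graph (carrier A) f) = ereal (real (2 * w))"
    proof (rule diam[OF _ x(1) y(1)])
      fix u v assume "u \<in> carrier A" "v \<in> carrier A"
      then show "\<exists>a b. a + b \<le> 2 * w \<and> (f ^^ a) u = (f ^^ b) v"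
        using top by (intro exI[of _ w]) simp
    next
      fix a b assume "(f ^^ a) x = (f ^^ b) y"
      then show "2 * w \<le> a + b"
        using distinct_branches[OF x(2) _ y(2) _ neq] top[OF x(1)] top[OF y(1)]
        unfolding Sw by force
    qed
    with six show ?thesis by (simp add: nilpotent_diameter_def)
  next
    case one
    obtain x where x: "x \<in> carrier A" "(f ^^ (w - 1)) x \<noteq> \<one>" using obtain_full_height .
    have last: "(f ^^ (w - 1)) u = (f ^^ (w - 1)) x"
      if "u \<in> carrier A" "(f ^^ (w - 1)) u \<noteq> \<one>" for u
      using full_height_unique[OF one(1) that x] .
    have upper: "\<exists>a b. a + b \<le> 2 * w - 1 \<and> (f ^^ a) u = (f ^^ b) v"
      if uv: "u \<in> carrier A" "v \<in> carrier A" for u v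
    proof -
      consider "(f ^^ (w - 1)) u = \<one>" | "(f ^^ (w - 1)) v = \<one>"
        | "(f ^^ (w - 1)) u = (f ^^ (w - 1)) v"
        using last[OF uv(1)] last[OF uv(2)] by argo
      then show ?thesis
      proof cases
        case 1
        then show ?thesis
          using top[OF uv(2)] by (intro exI[of _ "w - 1"] exI[of _ w]) auto
      next
        case 2
        then show ?thesis
          using top[OF uv(1)] by (intro exI[of _ w] exI[of _ "w - 1"]) auto
      next
        case 3
        then show ?thesis by (intro exI[of _ "w - 1"]) auto
      qed
    qed
    obtain y where y: "y \<in> carrier A"
      and lower: "\<And>a b. (f ^^ a) x = (f ^^ b) y \<Longrightarrow> 2 * w - 1 \<le> a + b"
    proof (cases "w = 1")
      case True
      show ?thesis
      proof (rule that[OF one_closed])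
        fix a b assume "(f ^^ a) x = (f ^^ b) \<one>"
        with x(2) True have "a \<noteq> 0" by (cases a) auto
        with True show "2 * w - 1 \<le> a + b" by simp
      qed
    next
      case False
      with w_pos have Sw2: "Suc (w - 2) = w - 1" by simp
      let ?K = "{u \<in> (f ^^ (w - 2)) ` carrier A. f u = \<one>}"
      have "card ?K > 2"
        using card_image_eq_twice_card_kernel[of "w - 2"] one False by (simp add: Sw2)
      then obtain u where "u \<in> ?K" "u \<noteq> \<one>" "u \<noteq> (f ^^ (w - 1)) x"
        by (rule obtain_third)
      then obtain y where y: "y \<in> carrier A" "(f ^^ (w - 2)) y \<noteq> \<one>"
        "(f ^^ Suc (w - 2)) y = \<one>" "(f ^^ (w - 1)) x \<noteq> (f ^^ (w - 2)) y"
        by auto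
      show ?thesis
      proof (rule that[OF y(1)])
        fix a b assume "(f ^^ a) x = (f ^^ b) y"
        then have "Suc (w - 1) + Suc (w - 2) \<le> a + b"
          using distinct_branches[OF x(2) _ y(2,3,4)] top[OF x(1)] unfolding Sw by blast
        then show "2 * w - 1 \<le> a + b" using Sw2 by linarith
      qed
    qed
    have "diameter (functional_graph (carrier A) f) = ereal (real (2 * w - 1))"
      using upper lower by (intro diam[OF _ x(1) y])
    with one show ?thesis by (simp add: nilpotent_diameter_def)
  next
    case two
    with w_pos have w2: "Suc (w - 2) = w - 1" "w \<ge> 2" by auto
    obtain x where x: "x \<in> carrier A" "(f ^^ (w - 1)) x \<noteq> \<one>" using obtain_full_height .
    let ?z = "(f ^^ (w - 1)) x"
    have last: "(f ^^ (w - 1)) u = ?z"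
      if "u \<in> carrier A" "(f ^^ (w - 1)) u \<noteq> \<one>" for u
      using full_height_unique[OF two(1) that x] .
    let ?K = "{u \<in> (f ^^ (w - 2)) ` carrier A. f u = \<one>}"
    have fx: "f x \<in> carrier A" using funpow_closed[of x 1] x by simp
    have zf: "?z = (f ^^ (w - 2)) (f x)" by (metis comp_apply funpow_Suc_right w2(1))
    have zK: "?z \<in> ?K"
      using zf fx top[OF x(1)] Sw by (metis (mono_tags, lifting) comp_apply funpow.simps(2) imageI mem_Collect_eq)
    have oneK: "\<one> \<in> ?K"
      using funpow_one[of "w - 2"] funpow_one[of 1] one_closed by (auto intro: rev_image_eqI)
    have "card ?K \<le> 2"
      using card_image_eq_twice_card_kernel[of "w - 2"] two by (simp add: w2)
    then have K: "?K = {\<one>, ?z}"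
      using zK oneK x(2) fin[of "w - 2"] card_seteq[of ?K "{\<one>, ?z}"] by auto
    \<comment> \<open>Below full height, a vertex is at the root or at \<open>?z\<close> after \<open>w - 2\<close> steps.\<close>
    have mixed: "\<exists>a b. a + b \<le> 2 * w - 2 \<and> (f ^^ a) u = (f ^^ b) v"
      if u: "u \<in> carrier A" "(f ^^ (w - 1)) u = ?z"
        and v: "v \<in> carrier A" "(f ^^ (w - 1)) v = \<one>" for u v
    proof -
      have "f ((f ^^ (w - 2)) v) = \<one>" using v(2) w2(1) by (metis comp_apply funpow.simps(2))
      then have "(f ^^ (w - 2)) v \<in> {\<one>, ?z}" using v(1) unfolding K[symmetric] by simp
      then show ?thesis
      proof
        assume "(f ^^ (w - 2)) v = \<one>"
        then show ?thesis
          using top[OF u(1)] w2 by (intro exI[of _ w] exI[of _ "w - 2"]) auto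
      next
        assume "(f ^^ (w - 2)) v \<in> {?z}"
        then show ?thesis
          using u(2) w2 by (intro exI[of _ "w - 1"] exI[of _ "w - 2"]) auto
      qed
    qed
    have upper: "\<exists>a b. a + b \<le> 2 * w - 2 \<and> (f ^^ a) u = (f ^^ b) v"
      if uv: "u \<in> carrier A" "v \<in> carrier A" for u v
    proof -
      consider "(f ^^ (w - 1)) u = (f ^^ (w - 1)) v"
        | "(f ^^ (w - 1)) u = ?z" "(f ^^ (w - 1)) v = \<one>"
        | "(f ^^ (w - 1)) v = ?z" "(f ^^ (w - 1)) u = \<one>"
        using last[OF uv(1)] last[OF uv(2)] by argo
      then show ?thesis
      proof cases
        case 1
        then show ?thesis by (intro exI[of _ "w - 1"]) auto
      next
        case 2
        then show ?thesis using mixed uv by blast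
      next
        case 3
        then obtain a b where "a + b \<le> 2 * w - 2" "(f ^^ a) v = (f ^^ b) u"
          using mixed[OF uv(2) _ uv(1)] by blast
        then show ?thesis by (intro exI[of _ b] exI[of _ a]) simp
      qed
    qed
    \<comment> \<open>The iterates of \<open>x\<close> and of \<open>x \<otimes> f x\<close> after \<open>w - 2\<close> steps differ by the factor \<open>?z\<close>.\<close>
    let ?y = "x \<otimes> f x"
    have y: "?y \<in> carrier A" using x fx by simp
    have y1: "(f ^^ (w - 1)) ?y = ?z"
    proof -
      have "(f ^^ (w - 1)) (f x) = \<one>"
        using top[OF x(1)] Sw by (metis comp_apply funpow_Suc_right)
      then show ?thesis using hom_mult[OF funpow_hom x(1) fx] x by simp
    qed
    have y2: "(f ^^ (w - 2)) x \<noteq> (f ^^ (w - 2)) ?y"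
    proof -
      have "(f ^^ (w - 2)) ?y = (f ^^ (w - 2)) x \<otimes> ?z"
        using hom_mult[OF funpow_hom x(1) fx] zf by simp
      then show ?thesis using x l_cancel_one'[of "(f ^^ (w - 2)) x" ?z] by auto
    qed
    have "diameter (functional_graph (carrier A) f) = ereal (real (2 * w - 2))"
      using upper full_height_split[OF x y _ y2] y1 x(2) by (intro diam[OF _ x(1) y]) auto
    with two show ?thesis by (simp add: nilpotent_diameter_def)
  qed
qed

end

section \<open>Multiples in cyclic groups\<close>

lemma dvd_power_of_prime_dvd:
  fixes N m :: nat
  assumes "N > 0" "\<And>p. Factorial_Ring.prime p \<Longrightarrow> p dvd N \<Longrightarrow> p dvd m"
  shows "\<exists>e. N dvd m ^ e"
  using assms
proof (induction N rule: less_induct)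
  case (less N)
  show ?case
  proof (cases "N = 1")
    case False
    then obtain p where p: "Factorial_Ring.prime p" "p dvd N" using prime_factor_nat by blast
    then obtain N' where N': "N = p * N'" by blast
    have "N' < N" "N' > 0" using N' less.prems(1) prime_gt_1_nat[OF p(1)] by auto
    then obtain e where "N' dvd m ^ e" using less.IH[of N'] less.prems(2) N' by auto
    moreover have "p dvd m" using less.prems(2) p by blast
    ultimately have "N dvd m ^ Suc e" unfolding N' by (simp add: mult_dvd_mono)
    then show ?thesis by blast
  qed auto
qed

lemma gcd_power_cong:
  fixes a b N :: nat
  assumes "gcd a N = gcd b N"
  shows "gcd (a ^ e) N = gcd (b ^ e) N"
proof (induction e)
  case (Suc e)
  have step: "gcd (x * y) N = gcd (gcd x N * y) N" for x y :: nat
  proof -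
    have "gcd (gcd x N * y) N = gcd (gcd (x * y) (N * y)) N"
      by (simp add: gcd_mult_distrib_nat mult.commute)
    also have "\<dots> = gcd (x * y) (gcd (N * y) N)" by (simp add: gcd.assoc)
    finally show ?thesis by (simp add: gcd.commute)
  qed
  have "gcd (a ^ Suc e) N = gcd (gcd a N * a ^ e) N" using step[of a "a ^ e"] by simp
  also have "\<dots> = gcd (gcd b N * gcd (a ^ e) N) N"
    using step[of "a ^ e" "gcd b N"] assms by (simp add: mult.commute)
  also have "\<dots> = gcd (gcd b N * b ^ e) N"
    using step[of "b ^ e" "gcd b N"] Suc by (simp add: mult.commute)
  also have "\<dots> = gcd (b ^ Suc e) N" using step[of b "b ^ e"] by simp
  finally show ?case .
qed simp

text \<open>
  The order of the subgroup of multiples of \<open>r\<close> in \<open>Z\<^sub>N\<close>; for \<open>N > 0\<close> it equals \<open>N / gcd r N\<close>.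
\<close>
definition multiple_count :: "nat \<Rightarrow> nat \<Rightarrow> nat" where
  "multiple_count N r =
     card ((\<lambda>x. x [^]\<^bsub>integer_mod_group N\<^esub> r) ` carrier (integer_mod_group N))"

text \<open>
  By Bezout, \<open>s\<close> is congruent modulo \<open>N\<close> to a multiple of \<open>r\<close>.
\<close>
lemma multiples_subset:
  assumes N: "N > 0" and dvd: "gcd r N dvd s"
  shows "(\<lambda>x. x [^]\<^bsub>integer_mod_group N\<^esub> s) ` carrier (integer_mod_group N)
    \<subseteq> (\<lambda>x. x [^]\<^bsub>integer_mod_group N\<^esub> r) ` carrier (integer_mod_group N)"
proof (rule image_subsetI)
  fix x :: int
  obtain u v where bezout: "u * int r + v * int N = gcd (int r) (int N)"
    using bezout_int by blast
  obtain q where "s = gcd r N * q" using dvd by blast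
  then have q: "int s = (u * int r + v * int N) * int q"
    by (simp add: bezout)
  let ?y = "(u * int q * x) mod int N"
  have "int r * ?y mod int N = int r * (u * int q * x) mod int N" by (simp add: mod_mult_right_eq)
  also have "\<dots> = (int r * (u * int q * x) + int N * (v * int q * x)) mod int N" by simp
  also have "\<dots> = int s * x mod int N" unfolding q by (simp add: algebra_simps)
  finally have "int s * x mod int N = int r * ?y mod int N" ..
  moreover have "?y \<in> carrier (integer_mod_group N)"
    using N by (simp add: carrier_integer_mod_group)
  ultimately show "x [^]\<^bsub>integer_mod_group N\<^esub> s
      \<in> (\<lambda>x. x [^]\<^bsub>integer_mod_group N\<^esub> r) ` carrier (integer_mod_group N)"
    by auto
qed

lemma multiple_count_cong:
  assumes "N > 0" "gcd r N = gcd s N"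
  shows "multiple_count N r = multiple_count N s"
  unfolding multiple_count_def
  using multiples_subset[of N r s] multiples_subset[of N s r] assms
  by (metis gcd_dvd1 subset_antisym)

lemma multiple_count_eq_1_iff:
  assumes "N > 0"
  shows "multiple_count N r = 1 \<longleftrightarrow> N dvd r"
proof
  assume "multiple_count N r = 1"
  then obtain z where z: "(\<lambda>x. x [^]\<^bsub>integer_mod_group N\<^esub> r) ` carrier (integer_mod_group N) = {z}"
    unfolding multiple_count_def using card_1_singletonE by blast
  have "0 \<in> {z}" unfolding z[symmetric]
    by (rule image_eqI[of _ _ 0]) (auto simp: assms carrier_integer_mod_group)
  moreover have "int r * (1 mod int N) mod int N \<in> {z}" unfolding z[symmetric]
    by (rule image_eqI[of _ _ "1 mod int N"]) (auto simp: assms carrier_integer_mod_group)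
  ultimately have "int r mod int N = 0" by (simp add: mod_mult_right_eq)
  then show "N dvd r" by (simp add: mod_eq_0_iff_dvd)
next
  assume "N dvd r"
  then have "x [^]\<^bsub>integer_mod_group N\<^esub> r = 0" for x :: int by auto
  moreover have "carrier (integer_mod_group N) \<noteq> {}" using integer_mod_group_0 by blast
  ultimately have "(\<lambda>x. x [^]\<^bsub>integer_mod_group N\<^esub> r) ` carrier (integer_mod_group N) = {0}"
    by (simp only: image_constant_conv if_False)
  then show "multiple_count N r = 1" by (simp add: multiple_count_def)
qed

lemma multiple_count_pos:
  assumes "N > 0"
  shows "multiple_count N r > 0"
proof -
  have "finite (carrier (integer_mod_group N))" "carrier (integer_mod_group N) \<noteq> {}"
    using assms by (auto simp: carrier_integer_mod_group)
  then show ?thesis by (simp add: multiple_count_def card_gt_0_iff)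
qed

text \<open>
  If two consecutive images coincide, then all later ones do too, and the last of them is trivial.
\<close>
lemma multiple_count_strict_decrease:
  assumes N: "N > 0" and nil: "N dvd m ^ w" and nontrivial: "\<not> N dvd m ^ e"
  shows "multiple_count N (m ^ Suc e) < multiple_count N (m ^ e)"
proof -
  let ?I = "\<lambda>e. (\<lambda>x. x [^]\<^bsub>integer_mod_group N\<^esub> (m ^ e)) ` carrier (integer_mod_group N)"
  interpret Z: group "integer_mod_group N" by simp
  have fin: "finite (?I e)" for e using N by (simp add: carrier_integer_mod_group)
  have suc: "?I (Suc e) = (\<lambda>x. x [^]\<^bsub>integer_mod_group N\<^esub> m) ` ?I e" for e
    unfolding image_image
    by (intro image_cong refl) (simp only: Z.nat_pow_pow power_Suc2)
  have sub: "?I (Suc e) \<subseteq> ?I e" using N by (intro multiples_subset) auto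
  moreover have "?I (Suc e) \<noteq> ?I e"
  proof
    assume eq: "?I (Suc e) = ?I e"
    have stable: "?I (e + t) = ?I e" for t
    proof (induction t)
      case (Suc t)
      then show ?case using suc[of "e + t"] suc[of e] eq by simp
    qed simp
    have "N dvd m ^ (e + w)" using nil by (simp add: power_add)
    then have "multiple_count N (m ^ e) = 1"
      using multiple_count_eq_1_iff[OF N, of "m ^ (e + w)"] stable[of w]
      unfolding multiple_count_def by metis
    then show False using multiple_count_eq_1_iff[OF N] nontrivial by simp
  qed
  ultimately show ?thesis
    unfolding multiple_count_def using fin by (intro psubset_card_mono) auto
qed

lemma (in group) funpow_nat_pow:
  "x \<in> carrier G \<Longrightarrow> ((\<lambda>x. x [^] (r::nat)) ^^ e) x = x [^] (r ^ e)"
proof (induction e)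
  case (Suc e)
  then show ?case by (simp add: nat_pow_pow mult.commute)
qed simp

lemma card_image_funpow_integer_mod_group:
  "card (((\<lambda>x. x [^]\<^bsub>integer_mod_group N\<^esub> r) ^^ e) ` carrier (integer_mod_group N)) =
     multiple_count N (r ^ e)"
  unfolding multiple_count_def
  by (rule arg_cong[where f = card], rule image_cong[OF refl])
     (simp only: group.funpow_nat_pow[OF group_integer_mod_group])

section \<open>Images in direct sums of cyclic groups\<close>

lemma group_cyclic_sum: "group (cyclic_sum i M)"
  unfolding cyclic_sum_def by (rule product_group) simp

lemma scale_closed:
  "x \<in> carrier (cyclic_sum i M) \<Longrightarrow> scale i M r x \<in> carrier (cyclic_sum i M)"
  unfolding cyclic_sum_def scale_def
  by (auto simp: PiE_iff simp del: pow_integer_mod_group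
      intro!: monoid.nat_pow_closed group.is_monoid)

lemma scale_hom: "scale i M r \<in> hom (cyclic_sum i M) (cyclic_sum i M)"
proof (rule homI)
  fix x y assume "x \<in> carrier (cyclic_sum i M)" "y \<in> carrier (cyclic_sum i M)"
  then show "scale i M r (x \<otimes>\<^bsub>cyclic_sum i M\<^esub> y) =
      scale i M r x \<otimes>\<^bsub>cyclic_sum i M\<^esub> scale i M r y"
    unfolding cyclic_sum_def scale_def
    by (auto simp: fun_eq_iff algebra_simps mod_simps)
qed (rule scale_closed)

lemma funpow_scale:
  assumes "x \<in> carrier (cyclic_sum i M)"
  shows "(scale i M r ^^ e) x = scale i M (\<lambda>j. r j ^ e) x"
proof (induction e)
  case 0
  have "x j mod int (M j) = x j" if "j \<in> {1..i}" for j
  proof -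
    have "x j \<in> carrier (integer_mod_group (M j))"
      using assms that by (auto simp: cyclic_sum_def)
    then show ?thesis by (auto simp: carrier_integer_mod_group split: if_splits)
  qed
  moreover have "x j = undefined" if "j \<notin> {1..i}" for j
    using assms that by (auto simp: cyclic_sum_def PiE_iff extensional_def)
  ultimately show ?case
    by (auto simp: fun_eq_iff scale_def)
next
  case (Suc e)
  then show ?case by (auto simp: fun_eq_iff scale_def mod_simps mult.assoc)
qed

lemma image_scale:
  "scale i M r ` carrier (cyclic_sum i M) =
     (\<Pi>\<^sub>E j\<in>{1..i}. (\<lambda>x. x [^]\<^bsub>integer_mod_group (M j)\<^esub> r j) ` carrier (integer_mod_group (M j)))"
  (is "_ = (\<Pi>\<^sub>E j\<in>_. ?f j ` ?C j)")
proof (intro equalityI subsetI)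
  fix y assume y: "y \<in> (\<Pi>\<^sub>E j\<in>{1..i}. ?f j ` ?C j)"
  then have "\<forall>j\<in>{1..i}. \<exists>x. x \<in> ?C j \<and> y j = ?f j x" by (auto simp: PiE_iff)
  then obtain x where x: "\<And>j. j \<in> {1..i} \<Longrightarrow> x j \<in> ?C j \<and> y j = ?f j (x j)" by metis
  have "y = scale i M r (restrict x {1..i})"
    using x y by (auto simp: fun_eq_iff scale_def PiE_iff extensional_def)
  moreover have "restrict x {1..i} \<in> carrier (cyclic_sum i M)"
    using x by (auto simp: cyclic_sum_def)
  ultimately show "y \<in> scale i M r ` carrier (cyclic_sum i M)" by blast
next
  fix y assume "y \<in> scale i M r ` carrier (cyclic_sum i M)"
  then show "y \<in> (\<Pi>\<^sub>E j\<in>{1..i}. ?f j ` ?C j)"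
    by (auto simp: scale_def cyclic_sum_def PiE_iff)
qed

lemma card_image_funpow_scale:
  "card ((scale i M r ^^ e) ` carrier (cyclic_sum i M)) =
     (\<Prod>j=1..i. multiple_count (M j) (r j ^ e))"
proof -
  have "(scale i M r ^^ e) ` carrier (cyclic_sum i M) =
      scale i M (\<lambda>j. r j ^ e) ` carrier (cyclic_sum i M)"
    by (intro image_cong refl funpow_scale)
  then show ?thesis
    unfolding image_scale multiple_count_def by (simp only: card_PiE finite_atLeastAtMost)
qed

lemma pow_cyclic_sum:
  assumes "x \<in> carrier (cyclic_sum i M)"
  shows "x [^]\<^bsub>cyclic_sum i M\<^esub> (r::nat) = scale i M (\<lambda>_. r) x"
proof (induction r)
  case 0
  show ?case by (auto simp: scale_def cyclic_sum_def)
next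
  case (Suc r)
  then show ?case
    by (auto simp: scale_def cyclic_sum_def fun_eq_iff mod_simps algebra_simps)
qed

text \<open>
  In the direct sum, the \<open>r\<close>-th power map is \<open>scale\<close> with constant multiplier \<open>r\<close>, and an isomorphism
  carries the iterated images of one power map to those of the other.
\<close>
lemma card_image_funpow_iso:
  assumes G: "group G" and iso: "G \<cong> cyclic_sum i M"
  shows "card (((\<lambda>x. x [^]\<^bsub>G\<^esub> r) ^^ e) ` carrier G) =
    (\<Prod>j=1..i. multiple_count (M j) (r ^ e))"
proof -
  let ?S = "cyclic_sum i M"
  interpret G: group G by fact
  interpret S: group ?S by (rule group_cyclic_sum)
  obtain h where h: "h \<in> Group.iso G ?S" using iso by (auto simp: is_iso_def)
  then have hom: "h \<in> hom G ?S" and bij: "bij_betw h (carrier G) (carrier ?S)"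
    by (auto simp: Group.iso_def)
  let ?I = "(\<lambda>x. x [^]\<^bsub>G\<^esub> (r ^ e)) ` carrier G"
  have "((\<lambda>x. x [^]\<^bsub>G\<^esub> r) ^^ e) ` carrier G = ?I"
    by (intro image_cong refl G.funpow_nat_pow)
  moreover have "?I \<subseteq> carrier G" by auto
  then have "card (h ` ?I) = card ?I"
    by (rule card_image[OF inj_on_subset[OF bij_betw_imp_inj_on[OF bij]]])
  moreover have "h ` ?I = (\<lambda>y. y [^]\<^bsub>?S\<^esub> (r ^ e)) ` (h ` carrier G)"
    unfolding image_image
    by (intro image_cong refl hom_nat_pow[OF hom]) (auto simp: G S.is_group)
  moreover have "h ` carrier G = carrier ?S" using bij by (simp add: bij_betw_def)
  moreover have "(\<lambda>y. y [^]\<^bsub>?S\<^esub> (r ^ e)) ` carrier ?S =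
      (scale i M (\<lambda>_. r) ^^ e) ` carrier ?S"
    by (intro image_cong refl) (simp only: pow_cyclic_sum funpow_scale)
  ultimately show ?thesis by (simp only: card_image_funpow_scale)
qed

section \<open>Diameters of power graphs and product graphs\<close>

theorem theorem4p6:
  fixes H :: "('a, 'b) monoid_scheme"
    and M d w :: "nat \<Rightarrow> nat"
    and i n m k :: nat
  assumes "comm_group H" and "\<not> cyclic_group H"
    and "order H = n" and "n > 1" and "\<not> Factorial_Ring.prime n"
    and "i \<ge> 2" and "M 1 \<ge> 2" and "\<forall>j\<in>{1..<i}. M j dvd M (j + 1)"
    and "H \<cong> cyclic_sum i M" and "n = (\<Prod>j=1..i. M j)"
    and "m > 1" and "\<forall>p. Factorial_Ring.prime p \<and> p dvd n \<longrightarrow> p dvd m"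
    and "k = gcd m n"
    and "\<forall>j\<in>{1..i}. d j = gcd m (M j)"
    and "\<forall>j\<in>{1..i}. w j = (LEAST e. e > 0 \<and> M j dvd d j ^ e)"
  shows "(\<forall>j\<in>{1..i}. d j = gcd k (M j))
    \<and> (w (i - 1) = w i \<or> diameter (power_graph (d i) (integer_mod_group (M i))) = ereal (2 * real (w i))
        \<longrightarrow> diameter (power_graph m H) = ereal (2 * real (w i))
          \<and> diameter (power_graph k H) = ereal (2 * real (w i))
          \<and> diameter (product_graph i M d) = ereal (2 * real (w i)))
    \<and> (int (w (i - 1)) = int (w i) - 1
        \<and> diameter (power_graph (d i) (integer_mod_group (M i))) \<noteq> ereal (2 * real (w i))
        \<longrightarrow> diameter (power_graph m H) = ereal (2 * real (w i) - 1)
          \<and> diameter (power_graph k H) = ereal (2 * real (w i) - 1)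
          \<and> diameter (product_graph i M d) = ereal (2 * real (w i) - 1))
    \<and> ((\<exists>c::int. c \<ge> 2 \<and> int (w (i - 1)) = int (w i) - c)
        \<longrightarrow> diameter (power_graph m H) = diameter (power_graph (d i) (integer_mod_group (M i)))
          \<and> diameter (power_graph k H) = diameter (power_graph (d i) (integer_mod_group (M i)))
          \<and> diameter (product_graph i M d) = diameter (power_graph (d i) (integer_mod_group (M i))))"
proof -
  interpret H: comm_group H by fact
  note chain = assms(8) and n_eq = assms(10) and m_gt = assms(11) and rad = assms(12)
    and k_eq = assms(13) and d_eq = assms(14) and w_eq = assms(15)
  obtain i' where i': "i = Suc i'" "i' \<ge> 1" using \<open>i \<ge> 2\<close> by (cases i) auto
  have M_dvd_n: "M j dvd n" if "j \<in> {1..i}" for j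
    using that unfolding n_eq by (intro dvd_prodI) auto
  have M_pos: "M j > 0" if "j \<in> {1..i}" for j
    using M_dvd_n[OF that] \<open>n > 1\<close> by (auto intro: Nat.gr0I)
  have M_mono: "M j dvd M l" if "j \<le> l" "1 \<le> j" "l \<le> i" for j l
    using that
  proof (induction l rule: dec_induct)
    case (step l)
    then show ?case using chain by (auto intro: dvd_trans)
  qed simp
  have M_ge2: "M j \<ge> 2" if "j \<in> {1..i}" for j
    using M_mono[of 1 j] M_pos[OF that] that \<open>M 1 \<ge> 2\<close> by (auto dest!: dvd_imp_le)

  have gcd_d: "gcd (d j) (M j) = gcd m (M j)" if "j \<in> {1..i}" for j
    using d_eq that by (simp add: gcd.assoc)
  have gcd_k: "gcd k (M j) = gcd m (M j)" if "j \<in> {1..i}" for j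
    using M_dvd_n[OF that] unfolding k_eq by (simp add: gcd.assoc gcd_nat.absorb2)

  \<comment> \<open>The number \<open>w j\<close> can be computed with \<open>m\<close> in place of \<open>d j\<close>, since both have the same
    greatest common divisor with \<open>M j\<close>.\<close>
  have w_iff: "M j dvd m ^ e \<longleftrightarrow> w j \<le> e" and w_pos: "w j > 0" if j: "j \<in> {1..i}" for j e
  proof -
    have d_iff: "M j dvd d j ^ e \<longleftrightarrow> M j dvd m ^ e" for e
      unfolding gcd_nat.absorb_iff2 gcd_power_cong[OF gcd_d[OF j], of e] ..
    let ?P = "\<lambda>e. e > 0 \<and> M j dvd m ^ e"
    have w: "w j = (LEAST e. ?P e)" using w_eq j by (simp add: d_iff)
    obtain e0 where "M j dvd m ^ e0"
      using dvd_power_of_prime_dvd[of "M j" m] M_pos[OF j] rad dvd_trans[OF _ M_dvd_n[OF j]]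
      by auto
    then have "?P (Suc e0)" by (simp add: dvd_mult)
    then have P: "?P (w j)" unfolding w by (rule LeastI)
    then show "w j > 0" by simp
    show "M j dvd m ^ e \<longleftrightarrow> w j \<le> e"
    proof
      assume dvd: "M j dvd m ^ e"
      then have "e \<noteq> 0" using M_ge2[OF j] by (intro notI) auto
      then show "w j \<le> e" unfolding w using dvd by (intro Least_le) auto
    next
      assume "w j \<le> e"
      then show "M j dvd m ^ e" using P le_imp_power_dvd dvd_trans by blast
    qed
  qed
  have w_mono: "w j \<le> w l" if "j \<le> l" "1 \<le> j" "l \<le> i" for j l
    using w_iff[of j "w l"] w_iff[of l "w l"] M_mono[OF that] that by (auto intro: dvd_trans)

  define c where "c j e = multiple_count (M j) (m ^ e)" for j e
  define C where "C e = (\<Prod>j=1..i. c j e)" for e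
  define W where "W = w i"
  have i_in: "i \<in> {1..i}" "i' \<in> {1..i}" using i' by auto
  have W_pos: "W > 0" using w_pos i_in W_def by auto
  have c_1: "c j e = 1 \<longleftrightarrow> w j \<le> e" if "j \<in> {1..i}" for j e
    using multiple_count_eq_1_iff[OF M_pos[OF that]] w_iff[OF that] by (simp add: c_def)
  have c_pos: "c j e > 0" if "j \<in> {1..i}" for j e
    using multiple_count_pos[OF M_pos[OF that]] by (simp add: c_def)
  have c_gt: "c j e > 1" if "j \<in> {1..i}" "e < w j" for j e
    using c_1[OF that(1), of e] c_pos[OF that(1), of e] that(2) by linarith
  have C_two: "c i' e * c i e \<le> C e" for e
  proof -
    have "c i' e dvd (\<Prod>j=1..i'. c j e)" using i' by (intro dvd_prodI) auto
    moreover have "(\<Prod>j=1..i'. c j e) > 0" using c_pos i' by (intro prod_pos) auto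
    ultimately have "c i' e \<le> (\<Prod>j=1..i'. c j e)" by (rule dvd_imp_le)
    then show ?thesis unfolding C_def i' by simp
  qed
  have C_single: "C e = c i e" if "w i' \<le> e" for e
  proof -
    have "c j e = 1" if "j \<in> {1..i'}" for j
      using c_1[of j e] w_mono[of j i'] that i' \<open>w i' \<le> e\<close> by auto
    then have "(\<Prod>j=1..i'. c j e) = 1" by (intro prod.neutral) auto
    then show ?thesis unfolding C_def i' by simp
  qed
  have C_ge: "c i e \<le> C e" for e
    using C_two[of e] c_pos[OF i_in(2), of e] by (cases "c i' e") auto
  have ci_W: "c i W = 1" and ci_gt: "c i (W - 1) > 1"
    using c_1[OF i_in(1)] c_gt[OF i_in(1)] W_pos by (auto simp: W_def)
  have C_W: "C W = 1" using C_single[of W] w_mono[of i' i] ci_W i' by (simp add: W_def)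
  have C_gt: "C (W - 1) > 1" using ci_gt C_ge[of "W - 1"] by linarith

  have pow_cong: "multiple_count (M j) (r ^ e) = c j e"
    if "gcd r (M j) = gcd m (M j)" "j \<in> {1..i}" for r j e
    unfolding c_def by (rule multiple_count_cong[OF M_pos[OF that(2)] gcd_power_cong[OF that(1)]])

  have diam_H: "diameter (power_graph r H) = ereal (real (nilpotent_diameter C W))"
    if r: "\<And>j. j \<in> {1..i} \<Longrightarrow> gcd r (M j) = gcd m (M j)" for r
  proof -
    let ?f = "\<lambda>x. x [^]\<^bsub>H\<^esub> r"
    have rank: "card ((?f ^^ e) ` carrier H) = C e" for e
      using card_image_funpow_iso[OF H.is_group \<open>H \<cong> cyclic_sum i M\<close>, where r = r and e = e]
      by (simp add: C_def pow_cong r)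
    interpret nilpotent_endomorphism H ?f W
    proof
      show "?f \<in> hom H H" by (auto simp: hom_def H.nat_pow_distrib)
      show "finite (carrier H)"
        using \<open>order H = n\<close> \<open>n > 1\<close> by (intro card_ge_0_finite) (simp add: order_def)
    qed (use W_pos C_W C_gt rank in auto)
    show ?thesis
      unfolding power_graph_eq_functional_graph diameter_eq rank ..
  qed
  have diam_P: "diameter (product_graph i M d) = ereal (real (nilpotent_diameter C W))"
  proof -
    let ?S = "cyclic_sum i M"
    have rank: "card ((scale i M d ^^ e) ` carrier ?S) = C e" for e
      by (simp add: card_image_funpow_scale C_def pow_cong gcd_d)
    interpret S: group ?S by (rule group_cyclic_sum)
    interpret nilpotent_endomorphism ?S "scale i M d" W
    proof
      show "finite (carrier ?S)"
        unfolding cyclic_sum_def carrier_product_group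
        by (rule finite_PiE) (use M_pos in \<open>force simp: carrier_integer_mod_group\<close>)+
    qed (use W_pos C_W C_gt rank scale_hom in auto)
    show ?thesis
      unfolding product_graph_eq_functional_graph diameter_eq rank ..
  qed
  have diam_Z: "diameter (power_graph (d i) (integer_mod_group (M i))) =
      ereal (real (nilpotent_diameter (c i) W))"
  proof -
    let ?Z = "integer_mod_group (M i)" and ?f = "\<lambda>x. x [^]\<^bsub>integer_mod_group (M i)\<^esub> d i"
    have rank: "card ((?f ^^ e) ` carrier ?Z) = c i e" for e
      by (simp only: card_image_funpow_integer_mod_group pow_cong[OF gcd_d[OF i_in(1)] i_in(1)])
    interpret Z: comm_group ?Z by simp
    interpret nilpotent_endomorphism ?Z ?f W
    proof
      show "?f \<in> hom ?Z ?Z"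
        by (auto simp: hom_def Z.nat_pow_distrib simp del: pow_integer_mod_group mult_integer_mod_group)
      show "finite (carrier ?Z)" using M_pos[OF i_in(1)] by (simp add: carrier_integer_mod_group)
    qed (use W_pos ci_W ci_gt rank in \<open>simp_all only:\<close>)
    show ?thesis
      unfolding power_graph_eq_functional_graph diameter_eq rank ..
  qed
  have diam_m: "diameter (power_graph m H) = ereal (real (nilpotent_diameter C W))"
    by (rule diam_H) simp
  have diam_k: "diameter (power_graph k H) = ereal (real (nilpotent_diameter C W))"
    by (rule diam_H) (rule gcd_k)
  note diams = diam_m diam_k diam_P diam_Z

  have stmt1: "nilpotent_diameter C W = 2 * W"
    if "w i' = W \<or> nilpotent_diameter (c i) W = 2 * W"
  proof -
    have "C (W - 1) > 2"
      using that
    proof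
      assume "w i' = W"
      then have "c i' (W - 1) \<ge> 2" using c_gt[OF i_in(2), of "W - 1"] W_pos by simp
      then have "2 * 2 \<le> c i' (W - 1) * c i (W - 1)" using ci_gt by (intro mult_le_mono) auto
      with C_two[of "W - 1"] show ?thesis by linarith
    next
      assume "nilpotent_diameter (c i) W = 2 * W"
      then have "c i (W - 1) > 2"
        using W_pos by (auto simp: nilpotent_diameter_def split: if_splits)
      with C_ge[of "W - 1"] show ?thesis by linarith
    qed
    then show ?thesis by (simp add: nilpotent_diameter_def)
  qed
  have stmt2: "nilpotent_diameter C W = 2 * W - 1"
    if W: "W = Suc (w i')" and small: "nilpotent_diameter (c i) W \<noteq> 2 * W"
  proof -
    have wi': "w i' > 0" using w_pos i_in by blast
    then have W2: "Suc (W - 2) = W - 1" using W by simp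
    have two: "c i (W - 1) = 2"
      using small ci_gt by (auto simp: nilpotent_diameter_def split: if_splits)
    \<comment> \<open>The last factor decreases strictly until it is 1, so it is at least 3 at \<open>W - 2\<close>. The
      previous summand contributes a factor of at least 2.\<close>
    have "\<not> M i dvd m ^ (W - 2)" "M i dvd m ^ W"
      using w_iff[OF i_in(1), of "W - 2"] w_iff[OF i_in(1), of W] W wi'
      by (simp_all add: W_def del: power_Suc)
    then have "c i (Suc (W - 2)) < c i (W - 2)"
      unfolding c_def using multiple_count_strict_decrease[OF M_pos[OF i_in(1)]] by metis
    then have "c i (W - 1) < c i (W - 2)" unfolding W2 .
    moreover have "c i' (W - 2) > 1" using c_gt[OF i_in(2)] W wi' by auto
    ultimately have "2 * 3 \<le> c i' (W - 2) * c i (W - 2)" using two by (intro mult_le_mono) auto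
    then have "C (W - 2) > 4" using C_two[of "W - 2"] by linarith
    moreover have "C (W - 1) = 2" using C_single[of "W - 1"] two W by simp
    ultimately show ?thesis by (simp add: nilpotent_diameter_def)
  qed
  have stmt3: "nilpotent_diameter C W = nilpotent_diameter (c i) W" if "w i' + 2 \<le> W"
    using C_single[of "W - 1"] C_single[of "W - 2"] that by (simp add: nilpotent_diameter_def)

  have i1: "i - 1 = i'" using i' by simp
  have ereal_2W: "ereal (2 * real W) = ereal (real (2 * W))"
    and ereal_2W': "ereal (2 * real W - 1) = ereal (real (2 * W - 1))"
    using W_pos by (auto simp: of_nat_diff)
  show ?thesis
    unfolding i1 W_def[symmetric] diams ereal_2W ereal_2W'
  proof (intro conjI ballI impI)
    fix j assume "j \<in> {1..i}"
    then show "d j = gcd k (M j)" using gcd_k d_eq by simp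
  qed (use stmt1 stmt2 stmt3 in auto)
qed

end
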